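(* For $x,y,\xi\in[0,1]$ we have $$H(\xi,y)-H(\xi,x)=\mathcal{T}(y)-\mathcal{T}(x)-\int_x^yS(\xi,z)\,\mathrm{d}z.$$ For $x,\xi,\eta\in[0,1]$ we have $$H(\eta,x)-H(\xi,x)=\int_0^x\big(S(\xi,z)-S(\eta,z)\big)\,\mathrm{d}z=x\big(S(\xi,0)-S(\eta,0)\big).$$
   Context: $\gamma\in(1/2,1)$, $\kappa=\frac1{2\gamma}$; $\Phi(y)=d(y,\mathbb{Z})$ is the distance of $y\in\mathbb{R}$ to the nearest integer; $\mathcal{T}(x)=\sum_{n=0}^\infty\gamma^n\Phi(2^nx)$, $x\in[0,1]$. Binary digits: for $(\xi,x)\in[0,1]^2$ write $\xi=\sum_{n\ge0}\bar\xi_{-n}2^{-(n+1)}$, $x=\sum_{n\ge1}\bar x_n2^{-n}$ with digits in $\{0,1\}$; when there are two expansions, the one not ending in zeros is chosen. The iterates of the baker transformation $B=(B_1,B_2)$ are, for $k\ge0$, $$B^k(\xi,x)=\Big(\sum_{n\ge0}\bar\xi_{-n-k}2^{-(n+1)},\ \sum_{j=0}^{k-1}\bar\xi_{-j}2^{-(k-j)}+\frac{x}{2^k}\Big),$$ and for $k\ge1$ $$B^{-k}(\xi,x)=\Big(\frac{\xi}{2^k}+\sum_{j=1}^k\bar x_j2^{-(k-j+1)},\ \sum_{n\ge1}\bar x_{n+k}2^{-n}\Big);$$ $B^k=(B_1^k,B_2^k)$ denotes the components. $S(\xi,x)=-\sum_{n=1}^\infty\kappa^n\Phi'(B_2^n(\xi,x))$,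 where $\Phi'=1$ on the first half and $-1$ on the second half of $[0,1]$; at the breakpoints $\Phi'(B_2^n(\xi,x))$ is read off from the leading digit, i.e. it is $1$ if $\bar\xi_{-n+1}=0$ and $-1$ if $\bar\xi_{-n+1}=1$. $H(\xi,x)=\sum_{n\in\mathbb{Z}}\gamma^n\big[\Phi(B_2^{-n}(\xi,x))-\Phi(B_2^{-n}(\xi,0))\big]$. *)

theory Defs
  imports "HOL-Analysis.Analysis"
begin

definition binary_expansion :: "real \<Rightarrow> (nat \<Rightarrow> nat) \<Rightarrow> bool" where
  "binary_expansion x d \<longleftrightarrow>
     (\<forall>n. d n \<in> {0, 1}) \<and> (\<lambda>n. real (d n) / 2 ^ (n + 1)) sums x"

text \<open>Digits are indexed from 0 for both coordinates: in the two-sided notation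
  \<open>(\<dots>, \<xi>\<^sub>-\<^sub>1, \<xi>\<^sub>0, x\<^sub>1, x\<^sub>2, \<dots>)\<close> one has
  \<open>\<xi>\<^sub>-\<^sub>n = digit \<xi> n\<close> for \<open>n \<ge> 0\<close> and \<open>x\<^sub>n = digit x (n - 1)\<close> for \<open>n \<ge> 1\<close>.
  The points 0 and 1 have only one expansion in \<open>[0,1]\<close>, so 0 has all digits 0.\<close>

definition digit :: "real \<Rightarrow> nat \<Rightarrow> nat" where
  "digit x = (THE d. binary_expansion x d \<and>
     ((\<exists>d'. binary_expansion x d' \<and> d' \<noteq> d) \<longrightarrow> \<not> (\<exists>N. \<forall>n\<ge>N. d n = 0)))"

text \<open>\<open>baker k\<close> is the \<open>k\<close>-th iterate of the baker transformation, for every integer \<open>k\<close>.\<close>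

definition baker :: "int \<Rightarrow> real \<times> real \<Rightarrow> real \<times> real" where
  "baker k = (\<lambda>(\<xi>, x).
     if k \<ge> 0 then
       (let m = nat k in
         (\<Sum>n. real (digit \<xi> (n + m)) / 2 ^ (n + 1),
          (\<Sum>j<m. real (digit \<xi> j) / 2 ^ (m - j)) + x / 2 ^ m))
     else
       (let m = nat (- k) in
         (\<xi> / 2 ^ m + (\<Sum>j=1..m. real (digit x (j - 1)) / 2 ^ (m - j + 1)),
          \<Sum>n. real (digit x (n + m)) / 2 ^ (n + 1))))"

definition baker2 :: "int \<Rightarrow> real \<Rightarrow> real \<Rightarrow> real" where
  "baker2 k \<xi> x = snd (baker k (\<xi>, x))"

definition \<Phi> :: "real \<Rightarrow> real" where
  "\<Phi> y = infdist y \<int>"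

definition takagi :: "real \<Rightarrow> real \<Rightarrow> real" where
  "takagi \<gamma> x = (\<Sum>n. \<gamma> ^ n * \<Phi> (2 ^ n * x))"

text \<open>The value of \<open>\<Phi>'\<close> at \<open>baker2 n \<xi> x\<close>, for \<open>n \<ge> 1\<close>. At the breakpoints 0, 1/2, 1 it is
  determined by the leading digit \<open>\<xi>\<^sub>-\<^sub>n\<^sub>+\<^sub>1\<close> of that point, hence the dependence on \<open>n\<close>, \<open>\<xi>\<close>
  and \<open>x\<close> rather than on the point alone.\<close>

definition dPhi_baker2 :: "nat \<Rightarrow> real \<Rightarrow> real \<Rightarrow> real" where
  "dPhi_baker2 n \<xi> x =
     (let z = baker2 (int n) \<xi> x in
        if 0 < z \<and> z < 1/2 then 1
        else if 1/2 < z \<and> z < 1 then -1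
        else if digit \<xi> (n - 1) = 0 then 1 else -1)"

definition \<kappa> :: "real \<Rightarrow> real" where
  "\<kappa> \<gamma> = 1 / (2 * \<gamma>)"

definition S :: "real \<Rightarrow> real \<Rightarrow> real \<Rightarrow> real" where
  "S \<gamma> \<xi> x = - (\<Sum>n. \<kappa> \<gamma> ^ Suc n * dPhi_baker2 (Suc n) \<xi> x)"

definition H :: "real \<Rightarrow> real \<Rightarrow> real \<Rightarrow> real" where
  "H \<gamma> \<xi> x =
     (\<Sum>\<^sub>\<infinity>n\<in>(UNIV :: int set). \<gamma> powi n * (\<Phi> (baker2 (- n) \<xi> x) - \<Phi> (baker2 (- n) \<xi> 0)))"

end

theory Submission
  imports Defs
begin

text \<open>For \<open>\<xi>\<close> fixed, all points \<open>B\<^sub>2\<^sup>k(\<xi>, x)\<close> with \<open>0 \<le> x \<le> 1\<close> and \<open>k \<ge> 1\<close> lie in the same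
  closed half of \<open>[0,1]\<close>, the one selected by the leading digit \<open>\<xi>\<^sub>-\<^sub>k\<^sub>+\<^sub>1\<close>. Hence \<open>S(\<xi>, x)\<close> does not
  depend on \<open>x\<close>, and the terms of \<open>H\<close> with negative index sum to \<open>- x S(\<xi>, 0)\<close>. The other terms sum to
  the Takagi function, since \<open>B\<^sub>2\<^sup>-\<^sup>n(\<xi>, x)\<close> differs from \<open>2\<^sup>n x\<close> by an integer. So
  \<open>H(\<xi>, x) = T(x) - x S(\<xi>, 0)\<close>, which gives both claims.\<close>

section \<open>Binary expansions and the function \<open>digit\<close>\<close>

lemma binary_expansion_Suc:
  assumes "binary_expansion x d"
  shows "binary_expansion (2 * x - real (d 0)) (\<lambda>n. d (Suc n))"
proof -
  have "(\<lambda>n. real (d n) / 2 ^ (n + 1)) sums x"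
    using assms by (simp add: binary_expansion_def)
  then have "(\<lambda>n. real (d (Suc n)) / 2 ^ (Suc n + 1)) sums (x - real (d 0) / 2)"
    by (subst sums_Suc_iff) simp
  then have "(\<lambda>n. 2 * (real (d (Suc n)) / 2 ^ (Suc n + 1))) sums (2 * (x - real (d 0) / 2))"
    by (rule sums_mult)
  then show ?thesis
    using assms by (simp add: binary_expansion_def algebra_simps)
qed

text \<open>The integer \<open>i\<close> is the one whose binary digits are the first
  \<open>N\<close> digits of \<open>d\<close>. Later only its integrality matters, since \<Phi> has
  period 1.\<close>

lemma binary_expansion_shift:
  assumes "binary_expansion x d"
  shows "\<exists>i::int. binary_expansion (2 ^ N * x - of_int i) (\<lambda>n. d (n + N))"
proof (induction N)
  case 0
  show ?case using assms by (intro exI[of _ 0]) simp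
next
  case (Suc N)
  then obtain i :: int where "binary_expansion (2 ^ N * x - of_int i) (\<lambda>n. d (n + N))"
    by blast
  from binary_expansion_Suc[OF this] show ?case
    by (intro exI[of _ "2 * i + int (d N)"]) (simp add: algebra_simps)
qed

lemma binary_expansion_bounds:
  assumes "binary_expansion x d"
  shows "0 \<le> x" "x \<le> 1"
proof -
  have s: "(\<lambda>n. real (d n) / 2 ^ (n + 1)) sums x" and d: "\<And>n. d n \<in> {0, 1}"
    using assms by (auto simp: binary_expansion_def)
  show "0 \<le> x"
    using s by (rule sums_le[OF _ sums_zero, rotated]) simp
  have "real (d n) / 2 ^ (n + 1) \<le> (1/2) ^ Suc n" for n
    using d[of n] by (auto simp: field_simps)
  then show "x \<le> 1"
    using sums_le[OF _ s power_half_series] by blast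
qed

lemma binary_expansion_zero:
  assumes "binary_expansion 0 d"
  shows "d = (\<lambda>_. 0)"
proof
  fix n
  have s: "(\<lambda>n. real (d n) / 2 ^ (n + 1)) sums 0"
    using assms by (auto simp: binary_expansion_def)
  then have "real (d n) / 2 ^ (n + 1) = 0"
    using suminf_eq_zero_iff[of "\<lambda>n. real (d n) / 2 ^ (n + 1)"]
    by (auto simp: sums_iff)
  then show "d n = 0" by simp
qed

text \<open>An expansion that does not end in zeros determines its first digit: the rest lies in
  (0,1], so the digit is the ceiling of 2x minus 1. Induction on the shifted expansions gives the
  other digits.\<close>

lemma binary_expansion_unique:
  assumes "binary_expansion x d" "binary_expansion x e"
    and "\<not> (\<exists>N. \<forall>n\<ge>N. d n = 0)" "\<not> (\<exists>N. \<forall>n\<ge>N. e n = 0)"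
  shows "d n = e n"
  using assms
proof (induction n arbitrary: x d e)
  have shift: "\<not> (\<exists>N. \<forall>n\<ge>N. d (Suc n) = 0)" if "\<not> (\<exists>N. \<forall>n\<ge>N. d n = 0)" for d :: "nat \<Rightarrow> nat"
    using that by (metis Suc_le_D Suc_le_mono)
  {
    fix x and d :: "nat \<Rightarrow> nat"
    assume x: "binary_expansion x d" and d: "\<not> (\<exists>N. \<forall>n\<ge>N. d n = 0)"
    let ?y = "2 * x - real (d 0)"
    have y: "binary_expansion ?y (\<lambda>n. d (Suc n))"
      by (rule binary_expansion_Suc[OF x])
    \<comment> \<open>Excluding 0 makes the range of \<open>?y\<close> half-open, which is what pins
      down the ceiling of \<open>2 * x\<close>.\<close>
    have "?y \<noteq> 0"
    proof
      assume "?y = 0"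
      with y have "(\<lambda>n. d (Suc n)) = (\<lambda>_. 0)"
        by (intro binary_expansion_zero) simp
      with shift[OF d] show False by metis
    qed
    with binary_expansion_bounds[OF y] have "\<lceil>2 * x\<rceil> = int (d 0) + 1"
      by (intro ceiling_unique) auto
  }
  note first = this
  {
    case 0
    then show ?case using first[of x d] first[of x e] by simp
  next
    case (Suc n)
    have "d 0 = e 0"
      using Suc.prems first[of x d] first[of x e] by simp
    then show ?case
      using Suc.IH[of "2 * x - real (d 0)" "\<lambda>n. d (Suc n)" "\<lambda>n. e (Suc n)"]
        binary_expansion_Suc[OF Suc.prems(1)] binary_expansion_Suc[OF Suc.prems(2)]
        shift[OF Suc.prems(3)] shift[OF Suc.prems(4)]
      by simp
  }
qed

lemma binary_expansion_exists:
  assumes "0 < x" "x \<le> 1"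
  shows "\<exists>d. binary_expansion x d \<and> \<not> (\<exists>N. \<forall>n\<ge>N. d n = 0)"
proof -
  define c where "c n = \<lceil>2 ^ n * x\<rceil>" for n
  \<comment> \<open>\<open>c n - 1\<close> plays the role of the integer formed by the first
    \<open>n\<close> digits, so the next digit is \<open>(c (Suc n) - 1) - 2 * (c n - 1)\<close>.
    Ceilings rather than floors keep every partial sum strictly below \<open>x\<close>.\<close>
  define d where "d n = nat (c (Suc n) - 2 * c n + 1)" for n
  have c: "real_of_int (c n) - 1 < 2 ^ n * x" "2 ^ n * x \<le> real_of_int (c n)" for n
    unfolding c_def by linarith+
  \<comment> \<open>Doubling the bounds on \<open>2 ^ n * x\<close> and comparing with those at
    \<open>Suc n\<close> leaves two strict inequalities between integers, hence only two
    values.\<close>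
  have rng: "c (Suc n) - 2 * c n + 1 \<in> {0, 1}" for n
  proof -
    have "real_of_int (c (Suc n)) - 1 < real_of_int (2 * c n)"
      "real_of_int (2 * c n) - 2 < real_of_int (c (Suc n))"
      using c[of n] c[of "Suc n"] by auto
    then show ?thesis by auto
  qed
  have d: "d n \<in> {0, 1}" "real (d n) = real_of_int (c (Suc n) - 2 * c n + 1)" for n
    using rng[of n] by (auto simp: d_def)
  have c0: "c 0 = 1"
    unfolding c_def using assms by (intro ceiling_unique) auto
  have partial: "(\<Sum>n<N. real (d n) / 2 ^ (n + 1)) = (real_of_int (c N) - 1) / 2 ^ N" for N
    by (induction N) (simp_all add: c0 d(2) field_simps)
  have lt: "(\<Sum>n<N. real (d n) / 2 ^ (n + 1)) < x" for N
    unfolding partial using c(1)[of N] by (simp add: field_simps)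
  have "x - (1/2) ^ N \<le> (\<Sum>n<N. real (d n) / 2 ^ (n + 1))" for N
    unfolding partial using c(2)[of N] by (simp add: field_simps)
  moreover have "(\<lambda>N. x - (1/2) ^ N) \<longlonglongrightarrow> x - 0"
    by (intro tendsto_intros LIMSEQ_power_zero) simp
  ultimately have sums: "(\<lambda>n. real (d n) / 2 ^ (n + 1)) sums x"
    unfolding sums_def diff_0_right
    by (rule real_tendsto_sandwich[OF always_eventually[OF allI]
          always_eventually[OF allI[OF less_imp_le[OF lt]]] _ tendsto_const])
  have "\<not> (\<exists>N. \<forall>n\<ge>N. d n = 0)"
  proof
    assume "\<exists>N. \<forall>n\<ge>N. d n = 0"
    then obtain N where N: "\<forall>n\<ge>N. d n = 0" by blast
    \<comment> \<open>With zero digits from \<open>N\<close> on, the series would equal a partial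
      sum, which is strictly less than \<open>x\<close>.\<close>
    have "(\<lambda>n. real (d n) / 2 ^ (n + 1)) sums (\<Sum>n<N. real (d n) / 2 ^ (n + 1))"
      using N by (intro sums_finite) auto
    from sums_unique2[OF this sums] lt[of N] show False
      by simp
  qed
  with sums d(1) show ?thesis
    unfolding binary_expansion_def by blast
qed

text \<open>The definite description in \<open>digit\<close> is well defined: 0 has only the zero
  expansion, and every other point has exactly one expansion that does not end in zeros.\<close>

lemma binary_expansion_digit:
  assumes "0 \<le> x" "x \<le> 1"
  shows "binary_expansion x (digit x)"
proof -
  let ?P = "\<lambda>d. binary_expansion x d \<and>
     ((\<exists>d'. binary_expansion x d' \<and> d' \<noteq> d) \<longrightarrow> \<not> (\<exists>N. \<forall>n\<ge>N. d n = 0))"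
  have "\<exists>!d. ?P d"
  proof (cases "x = 0")
    case True
    have "binary_expansion 0 (\<lambda>_. 0)"
      by (simp add: binary_expansion_def)
    with True show ?thesis
      by (intro ex1I[of _ "\<lambda>_. 0"]) (auto dest: binary_expansion_zero)
  next
    case False
    with assms obtain e where e: "binary_expansion x e" "\<not> (\<exists>N. \<forall>n\<ge>N. e n = 0)"
      using binary_expansion_exists[of x] by auto
    show ?thesis
    proof (rule ex1I[of _ e])
      show "?P e" using e by blast
    next
      fix d assume d: "?P d"
      show "d = e"
      proof (rule ccontr)
        assume "d \<noteq> e"
        with d e have "\<not> (\<exists>N. \<forall>n\<ge>N. d n = 0)" by metis
        then have "d n = e n" for n
          using binary_expansion_unique d e by blast
        with \<open>d \<noteq> e\<close> show False by auto
      qed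
    qed
  qed
  from theI'[OF this] show ?thesis
    unfolding digit_def by blast
qed

lemma digit_range:
  assumes "0 \<le> x" "x \<le> 1"
  shows "digit x n = 0 \<or> digit x n = 1"
  using binary_expansion_digit[OF assms] by (auto simp: binary_expansion_def)

section \<open>The distance to the nearest integer\<close>

lemma infdist_greatest:
  assumes "A \<noteq> {}" "\<And>b. b \<in> A \<Longrightarrow> d \<le> dist x b"
  shows "d \<le> infdist x A"
  using assms by (simp add: infdist_notempty cINF_greatest)

lemma infdist_eqI:
  assumes "a \<in> A" "\<And>b. b \<in> A \<Longrightarrow> dist x a \<le> dist x b"
  shows "infdist x A = dist x a"
proof (rule antisym)
  show "infdist x A \<le> dist x a"
    using assms(1) by (rule infdist_le)
  show "dist x a \<le> infdist x A"
    using assms by (intro infdist_greatest) auto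
qed

lemma \<Phi>_lower_half:
  assumes "0 \<le> z" "z \<le> 1/2"
  shows "\<Phi> z = z"
proof -
  have "infdist z \<int> = dist z 0"
  proof (rule infdist_eqI)
    fix b :: real assume "b \<in> \<int>"
    then obtain i :: int where b: "b = of_int i" by (auto elim: Ints_cases)
    have "i \<le> 0 \<or> 1 \<le> i" by linarith
    then have "b \<le> 0 \<or> 1 \<le> b" by (auto simp: b)
    then show "dist z 0 \<le> dist z b"
      using assms by (auto simp: dist_real_def)
  qed simp
  then show ?thesis using assms by (simp add: \<Phi>_def)
qed

lemma \<Phi>_upper_half:
  assumes "1/2 \<le> z" "z \<le> 1"
  shows "\<Phi> z = 1 - z"
proof -
  have "infdist z \<int> = dist z 1"
  proof (rule infdist_eqI)
    fix b :: real assume "b \<in> \<int>"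
    then obtain i :: int where b: "b = of_int i" by (auto elim: Ints_cases)
    have "i \<le> 0 \<or> 1 \<le> i" by linarith
    then have "b \<le> 0 \<or> 1 \<le> b" by (auto simp: b)
    then show "dist z 1 \<le> dist z b"
      using assms by (auto simp: dist_real_def)
  qed simp
  then show ?thesis using assms by (simp add: \<Phi>_def dist_real_def)
qed

lemma \<Phi>_diff_of_int: "\<Phi> (y - of_int i) = \<Phi> y"
proof -
  \<comment> \<open>One inequality suffices: applied to \<open>y - of_int i\<close> and
    \<open>- i\<close>, it gives the reverse one.\<close>
  have le: "\<Phi> (y - of_int i) \<le> \<Phi> y" for y :: real and i :: int
  proof -
    have "infdist (y - of_int i) \<int> \<le> dist y b" if "b \<in> \<int>" for b
    proof -
      have "infdist (y - of_int i) \<int> \<le> dist (y - of_int i) (b - of_int i)"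
        using that by (intro infdist_le) auto
      then show ?thesis by (simp add: dist_real_def)
    qed
    moreover have "(\<int> :: real set) \<noteq> {}"
      using Ints_0 by blast
    ultimately show ?thesis
      unfolding \<Phi>_def by (intro infdist_greatest)
  qed
  from le[of y i] le[of "y - of_int i" "- i"] show ?thesis by simp
qed

lemma \<Phi>_bounds: "0 \<le> \<Phi> y" "\<Phi> y \<le> 1"
proof -
  show "0 \<le> \<Phi> y" by (simp add: \<Phi>_def infdist_nonneg)
  have "\<Phi> y \<le> dist y (of_int \<lfloor>y\<rfloor>)"
    unfolding \<Phi>_def by (rule infdist_le) simp
  also have "\<dots> \<le> 1" by (simp add: dist_real_def) linarith
  finally show "\<Phi> y \<le> 1" .
qed

lemma \<Phi>_zero: "\<Phi> 0 = 0"
  by (simp add: \<Phi>_lower_half)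

section \<open>Backward and forward iterates of the baker transformation\<close>

lemma \<Phi>_baker2_neg:
  assumes "0 \<le> x" "x \<le> 1"
  shows "\<Phi> (baker2 (- int n) \<xi> x) = \<Phi> (2 ^ n * x)"
proof (cases n)
  \<comment> \<open>Exponent 0 falls into the nonnegative branch of \<open>baker\<close>, where the
    second component is \<open>x\<close> itself.\<close>
  case 0
  then show ?thesis by (simp add: baker2_def baker_def)
next
  case (Suc m)
  obtain i :: int where "binary_expansion (2 ^ n * x - of_int i) (\<lambda>k. digit x (k + n))"
    using binary_expansion_shift[OF binary_expansion_digit[OF assms]] by blast
  then have "(\<Sum>k. real (digit x (k + n)) / 2 ^ (k + 1)) = 2 ^ n * x - of_int i"
    by (simp add: binary_expansion_def sums_iff)
  moreover have "baker2 (- int n) \<xi> x = (\<Sum>k. real (digit x (k + n)) / 2 ^ (k + 1))"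
    using Suc by (simp add: baker2_def baker_def Let_def nat_add_distrib)
  ultimately show ?thesis by (simp add: \<Phi>_diff_of_int)
qed

lemma baker2_of_nat:
  "baker2 (int m) \<xi> x = (\<Sum>j<m. real (digit \<xi> j) / 2 ^ (m - j)) + x / 2 ^ m"
  by (simp add: baker2_def baker_def)

text \<open>One more iteration prepends \<open>digit \<xi> m\<close> to the expansion, so this digit
  decides in which closed half of [0,1] the new point lies.\<close>

lemma baker2_Suc: "baker2 (int (Suc m)) \<xi> x = (real (digit \<xi> m) + baker2 (int m) \<xi> x) / 2"
proof -
  have "(\<Sum>j<m. real (digit \<xi> j) / 2 ^ (Suc m - j)) = (\<Sum>j<m. real (digit \<xi> j) / 2 ^ (m - j)) / 2"
    by (subst sum_divide_distrib, intro sum.cong) (auto simp: Suc_diff_le)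
  then show ?thesis
    unfolding baker2_of_nat by (simp add: field_simps)
qed

lemma baker2_bounds:
  assumes "0 \<le> \<xi>" "\<xi> \<le> 1" "0 \<le> x" "x \<le> 1"
  shows "0 \<le> baker2 (int m) \<xi> x \<and> baker2 (int m) \<xi> x \<le> 1"
proof (induction m)
  case 0
  show ?case using assms baker2_of_nat[of 0] by simp
next
  case (Suc m)
  then show ?case
    unfolding baker2_Suc using digit_range[of \<xi> m] assms by auto
qed

text \<open>The slope of \<Phi> on the closed half selected by the digit.\<close>

definition digit_sign :: "real \<Rightarrow> nat \<Rightarrow> real" where
  "digit_sign \<xi> n = (if digit \<xi> n = 0 then 1 else - 1)"

text \<open>Inside a half the slope agrees with the leading digit by \<open>baker2_Suc\<close>; at
  0, 1/2 and 1 the definition reads off that same digit.\<close>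

lemma dPhi_baker2_eq:
  assumes "0 \<le> \<xi>" "\<xi> \<le> 1" "0 \<le> x" "x \<le> 1"
  shows "dPhi_baker2 (Suc n) \<xi> x = digit_sign \<xi> n"
  unfolding dPhi_baker2_def Let_def baker2_Suc digit_sign_def
  using digit_range[of \<xi> n] baker2_bounds[OF assms, of n] assms by auto

text \<open>Both points lie in the same closed half, where \<Phi> is affine with slope
  \<open>digit_sign \<xi> n\<close>, and they differ by \<open>x / 2 ^ Suc n\<close>.\<close>

lemma \<Phi>_baker2_diff:
  assumes "0 \<le> \<xi>" "\<xi> \<le> 1" "0 \<le> x" "x \<le> 1"
  shows "\<Phi> (baker2 (int (Suc n)) \<xi> x) - \<Phi> (baker2 (int (Suc n)) \<xi> 0)
    = digit_sign \<xi> n * x / 2 ^ Suc n"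
proof -
  have diff: "baker2 (int (Suc n)) \<xi> x - baker2 (int (Suc n)) \<xi> 0 = x / 2 ^ Suc n"
    unfolding baker2_of_nat by simp
  have eq: "\<Phi> (baker2 (int (Suc n)) \<xi> z) =
      (if digit \<xi> n = 0 then baker2 (int (Suc n)) \<xi> z else 1 - baker2 (int (Suc n)) \<xi> z)"
    if "0 \<le> z" "z \<le> 1" for z
    using digit_range[of \<xi> n] baker2_bounds[of \<xi> z n] assms that
    unfolding baker2_Suc by (auto simp: \<Phi>_lower_half \<Phi>_upper_half)
  show ?thesis
    unfolding eq[OF assms(3,4)] eq[OF order_refl zero_le_one]
    using diff by (auto simp: digit_sign_def)
qed

section \<open>Evaluation of \<open>S\<close>, \<open>H\<close> and the integrals\<close>

lemma S_eq:
  assumes "0 \<le> \<xi>" "\<xi> \<le> 1" "0 \<le> x" "x \<le> 1"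
  shows "S \<gamma> \<xi> x = - (\<Sum>n. \<kappa> \<gamma> ^ Suc n * digit_sign \<xi> n)"
  unfolding S_def by (simp only: dPhi_baker2_eq[OF assms])

lemma H_eq:
  assumes "1/2 < \<gamma>" "\<gamma> < 1" and \<xi>: "0 \<le> \<xi>" "\<xi> \<le> 1" and x: "0 \<le> x" "x \<le> 1"
  shows "H \<gamma> \<xi> x = takagi \<gamma> x - x * S \<gamma> \<xi> 0"
proof -
  define f where
    "f n = \<gamma> powi n * (\<Phi> (baker2 (- n) \<xi> x) - \<Phi> (baker2 (- n) \<xi> 0))" for n :: int
  have \<kappa>: "0 < \<kappa> \<gamma>" "\<kappa> \<gamma> < 1"
    using assms by (auto simp: \<kappa>_def)

  \<comment> \<open>The subtracted term vanishes, as \<open>\<Phi> 0 = 0\<close>; what remains is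
    the Takagi series, dominated by the geometric series of \<gamma>.\<close>
  have f_pos: "f (int n) = \<gamma> ^ n * \<Phi> (2 ^ n * x)" for n
    unfolding f_def using x by (simp add: \<Phi>_baker2_neg \<Phi>_zero)
  have "summable (\<lambda>n. norm (f (int n)))"
  proof (rule summable_comparison_test')
    show "summable (\<lambda>n. \<gamma> ^ n)" using assms by (intro summable_geometric) simp
    show "norm (norm (f (int n))) \<le> \<gamma> ^ n" for n
      using \<Phi>_bounds[of "2 ^ n * x"] assms
      by (auto simp: f_pos abs_mult intro!: mult_left_le)
  qed
  moreover from this have "(\<lambda>n. f (int n)) sums takagi \<gamma> x"
    unfolding takagi_def f_pos[symmetric] by (rule summable_sums[OF summable_norm_cancel])
  ultimately have "((\<lambda>n. f (int n)) has_sum takagi \<gamma> x) UNIV"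
    by (rule norm_summable_imp_has_sum)
  then have pos: "(f has_sum takagi \<gamma> x) (range int)"
    by (subst has_sum_reindex) (auto simp: o_def)

  \<comment> \<open>The factor 1/\<gamma> from the weight and 1/2 from the contraction combine to
    \<kappa>, which turns these terms into those of \<open>S\<close>.\<close>
  have f_neg: "f (- int (Suc n)) = x * (\<kappa> \<gamma> ^ Suc n * digit_sign \<xi> n)" for n
  proof -
    have "f (- int (Suc n)) = inverse (\<gamma> ^ Suc n) * (digit_sign \<xi> n * x / 2 ^ Suc n)"
      unfolding f_def minus_minus \<Phi>_baker2_diff[OF \<xi> x] power_int_minus power_int_of_nat ..
    also have "\<dots> = x * (\<kappa> \<gamma> ^ Suc n * digit_sign \<xi> n)"
      unfolding \<kappa>_def power_divide power_mult_distrib by (simp add: divide_simps)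
    finally show ?thesis .
  qed
  \<comment> \<open>Absolute convergence holds because \<gamma> > 1/2 makes \<kappa> < 1; it is
    needed for the unordered sum over the integers.\<close>
  have summable_S: "summable (\<lambda>n. norm (\<kappa> \<gamma> ^ Suc n * digit_sign \<xi> n))"
  proof -
    have "summable (\<lambda>n. \<kappa> \<gamma> ^ Suc n)"
      using \<kappa> by (subst summable_Suc_iff) (intro summable_geometric, simp)
    then show ?thesis
      by (rule summable_cong[THEN iffD1, rotated])
        (use \<kappa> in \<open>auto simp: digit_sign_def abs_mult\<close>)
  qed
  have "(\<lambda>n. \<kappa> \<gamma> ^ Suc n * digit_sign \<xi> n) sums - S \<gamma> \<xi> 0"
    using summable_sums[OF summable_norm_cancel[OF summable_S]] \<xi> by (simp add: S_eq)
  then have "((\<lambda>n. \<kappa> \<gamma> ^ Suc n * digit_sign \<xi> n) has_sum - S \<gamma> \<xi> 0) UNIV"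
    by (rule norm_summable_imp_has_sum[OF summable_S])
  then have "((\<lambda>n. f (- int (Suc n))) has_sum x * - S \<gamma> \<xi> 0) UNIV"
    unfolding f_neg by (rule has_sum_cmult_right)
  then have neg: "(f has_sum x * - S \<gamma> \<xi> 0) (range (\<lambda>n. - int (Suc n)))"
    by (subst has_sum_reindex) (auto simp: o_def inj_def)

  \<comment> \<open>The index 0 belongs to the Takagi part; \<open>Suc\<close> in the other range
    keeps the two index sets disjoint.\<close>
  have "(f has_sum takagi \<gamma> x + x * - S \<gamma> \<xi> 0) (range int \<union> range (\<lambda>n. - int (Suc n)))"
    using pos neg by (rule has_sum_Un_disjoint) auto
  also have "range int \<union> range (\<lambda>n. - int (Suc n)) = UNIV"
    using int_cases by blast
  finally show ?thesis
    unfolding H_def f_def by (simp add: infsumI)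
qed

text \<open>The integrand is constant in \<open>z\<close> by \<open>S_eq\<close>. The integral is
  oriented, so the formula also covers \<open>y < x\<close>.\<close>

lemma interval_integral_S:
  assumes "0 \<le> \<xi>" "\<xi> \<le> 1" "x \<in> {0..1}" "y \<in> {0..1}"
  shows "(LBINT z=ereal x..ereal y. S \<gamma> \<xi> z) = (y - x) * S \<gamma> \<xi> 0"
proof -
  have "(LBINT z=ereal x..ereal y. S \<gamma> \<xi> z) = (LBINT z=ereal x..ereal y. S \<gamma> \<xi> 0)"
    using assms by (intro interval_integral_cong) (auto simp: S_eq einterval_iff min_def max_def split: if_splits)
  then show ?thesis by simp
qed

theorem lemma4p2:
  fixes \<gamma> :: real
  assumes "1/2 < \<gamma>" and "\<gamma> < 1"
  shows "(\<forall>x\<in>{0..1}. \<forall>y\<in>{0..1}. \<forall>\<xi>\<in>{0..1}.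
            H \<gamma> \<xi> y - H \<gamma> \<xi> x
              = takagi \<gamma> y - takagi \<gamma> x - (LBINT z=ereal x..ereal y. S \<gamma> \<xi> z)) \<and>
         (\<forall>x\<in>{0..1}. \<forall>\<xi>\<in>{0..1}. \<forall>\<eta>\<in>{0..1}.
            H \<gamma> \<eta> x - H \<gamma> \<xi> x = (LBINT z=ereal 0..ereal x. S \<gamma> \<xi> z - S \<gamma> \<eta> z) \<and>
            (LBINT z=ereal 0..ereal x. S \<gamma> \<xi> z - S \<gamma> \<eta> z) = x * (S \<gamma> \<xi> 0 - S \<gamma> \<eta> 0))"
proof (intro conjI ballI)
  fix x y \<xi> :: real
  assume "x \<in> {0..1}" "y \<in> {0..1}" "\<xi> \<in> {0..1}"
  then show "H \<gamma> \<xi> y - H \<gamma> \<xi> x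
      = takagi \<gamma> y - takagi \<gamma> x - (LBINT z=ereal x..ereal y. S \<gamma> \<xi> z)"
    using assms by (simp add: H_eq interval_integral_S algebra_simps)
next
  fix x \<xi> \<eta> :: real
  assume *: "x \<in> {0..1}" "\<xi> \<in> {0..1}" "\<eta> \<in> {0..1}"
  have "(LBINT z=ereal 0..ereal x. S \<gamma> \<xi> z - S \<gamma> \<eta> z)
      = (LBINT z=ereal 0..ereal x. S \<gamma> \<xi> 0 - S \<gamma> \<eta> 0)"
    using * by (intro interval_integral_cong) (auto simp: S_eq einterval_iff min_def max_def split: if_splits)
  then show int: "(LBINT z=ereal 0..ereal x. S \<gamma> \<xi> z - S \<gamma> \<eta> z) = x * (S \<gamma> \<xi> 0 - S \<gamma> \<eta> 0)"
    by simp
  show "H \<gamma> \<eta> x - H \<gamma> \<xi> x = (LBINT z=ereal 0..ereal x. S \<gamma> \<xi> z - S \<gamma> \<eta> z)"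
    unfolding int using * assms by (simp add: H_eq algebra_simps)
qed

end
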